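(* For every $n\in\mathbb{N}$, there is a set covering instance $(P,\mathcal{T},c)$ with $|P|=n$ players and nonempty core such that no family $\mathcal{C}'\subseteq\mathcal{C}$ with fewer than $2n-2$ elements determines the (happy) nucleolus.
   Context: A set covering instance $(P,\mathcal{T},c)$ consists of a finite set $P$ of players, a family $\mathcal{T}$ of subsets of $P$ whose union is $P$, and costs $c:\mathcal{T}\to\mathbb{R}_{\ge 0}$. For $\mathcal{U}\subseteq\mathcal{T}$ write $c(\mathcal{U})=\sum_{T\in\mathcal{U}}c(T)$; $\mathcal{U}$ covers $S\subseteq P$ if every element of $S$ lies in some set of $\mathcal{U}$. For $y\in\mathbb{R}^P$ write $y(S)=\sum_{p\in S}y_p$. A coalition is a nonempty subset of $P$. Let $\mathcal{C}$ be the set of pairs $(S,\mathcal{U})$ with $\emptyset\ne S\subseteq P$ and $\mathcal{U}\subseteq\mathcal{T}$ covering $S$. For $y\in\mathbb{R}^P_{\ge0}$, $\theta^y(S,\mathcal{U})=c(\mathcal{U})-y(S)$; $\theta^y(S)=\min\{\theta^y(S,\mathcal{U}):\mathcal{U}\subseteq\mathcal{T}\text{ covers }S\}$; the excess vector $\theta^y$ lists $\theta^y(S)$ over all coalitions in nondecreasing order; for $\mathcal{C}'\subseteq\mathcal{C}$, $\theta^y[\mathcal{C}']$ lists $\theta^y(S,\mathcal{U})$ for $(S,\mathcal{U})\in\mathcal{C}'$ in nondecreasing order. The core is the set of $y\in\mathbb{R}^P_{\ge0}$ with $y(P)$ equal to the minimum cost $\min\{c(\mathcal{U}):\mathcal{U}\subseteq\mathcal{T}\text{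 covers }P\}$ and $\theta^y(S)\ge0$ for all coalitions $S$. $\mathrm{LP}(P,\mathcal{T},c)=\min\{\sum_{T}c(T)x_T: x\in\mathbb{R}^{\mathcal{T}}_{\ge0},\ \sum_{T\ni p}x_T\ge1\ \forall p\in P\}$. The happy nucleolus is the (unique) $y\in\mathbb{R}^P_{\ge0}$ with $y(P)=\mathrm{LP}(P,\mathcal{T},c)$ lexicographically maximizing $\theta^y$ among such vectors; when the core is nonempty it coincides with the classical nucleolus. A family $\mathcal{C}'\subseteq\mathcal{C}$ determines the happy nucleolus if the happy nucleolus is the unique vector lexicographically maximizing $\theta^y[\mathcal{C}']$ among all $y\in\mathbb{R}^P_{\ge0}$ with $y(P)=\mathrm{LP}(P,\mathcal{T},c)$. *)

theory Defs
  imports Complex_Main "HOL-Library.Multiset" "HOL-Library.FuncSet"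
begin

text \<open>
  The vectors in \<open>\<real>\<^sup>P\<close> with nonnegative entries are represented by the extensional functions
  \<open>P \<rightarrow>\<^sub>E {0..}\<close>, so that two of them are equal iff they agree on \<open>P\<close>. Functions on the family
  \<open>\<T>\<close> (costs, fractional covers) are only ever evaluated at members of \<open>\<T>\<close>.
\<close>

definition set_covering_instance :: "'a set \<Rightarrow> 'a set set \<Rightarrow> ('a set \<Rightarrow> real) \<Rightarrow> bool" where
  "set_covering_instance P \<T> c \<longleftrightarrow> finite P \<and> \<Union>\<T> = P \<and> (\<forall>T\<in>\<T>. 0 \<le> c T)"

definition covers :: "'a set set \<Rightarrow> 'a set \<Rightarrow> bool" where
  "covers \<U> S \<longleftrightarrow> (\<forall>p\<in>S. \<exists>T\<in>\<U>. p \<in> T)"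

definition coalitions :: "'a set \<Rightarrow> 'a set set" where
  "coalitions P = {S. S \<subseteq> P \<and> S \<noteq> {}}"

definition covering_pairs :: "'a set \<Rightarrow> 'a set set \<Rightarrow> ('a set \<times> 'a set set) set" where
  "covering_pairs P \<T> = {(S, \<U>). S \<in> coalitions P \<and> \<U> \<subseteq> \<T> \<and> covers \<U> S}"

definition excess :: "('a set \<Rightarrow> real) \<Rightarrow> ('a \<Rightarrow> real) \<Rightarrow> 'a set \<times> 'a set set \<Rightarrow> real" where
  "excess c y = (\<lambda>(S, \<U>). sum c \<U> - sum y S)"

definition coalition_excess ::
    "'a set set \<Rightarrow> ('a set \<Rightarrow> real) \<Rightarrow> ('a \<Rightarrow> real) \<Rightarrow> 'a set \<Rightarrow> real" where
  "coalition_excess \<T> c y S = Min {excess c y (S, \<U>) | \<U>. \<U> \<subseteq> \<T> \<and> covers \<U> S}"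

text \<open>The values of \<open>f\<close> over a finite index set, with multiplicities, in nondecreasing order.\<close>

definition sorted_values :: "('i \<Rightarrow> real) \<Rightarrow> 'i set \<Rightarrow> real list" where
  "sorted_values f I = sorted_list_of_multiset (image_mset f (mset_set I))"

definition excess_vector ::
    "'a set \<Rightarrow> 'a set set \<Rightarrow> ('a set \<Rightarrow> real) \<Rightarrow> ('a \<Rightarrow> real) \<Rightarrow> real list" where
  "excess_vector P \<T> c y = sorted_values (coalition_excess \<T> c y) (coalitions P)"

definition restricted_excess_vector ::
    "('a set \<Rightarrow> real) \<Rightarrow> ('a set \<times> 'a set set) set \<Rightarrow> ('a \<Rightarrow> real) \<Rightarrow> real list" where
  "restricted_excess_vector c F y = sorted_values (excess c y) F"

definition min_cover_cost :: "'a set \<Rightarrow> 'a set set \<Rightarrow> ('a set \<Rightarrow> real) \<Rightarrow> real" where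
  "min_cover_cost P \<T> c = Min {sum c \<U> | \<U>. \<U> \<subseteq> \<T> \<and> covers \<U> P}"

definition core :: "'a set \<Rightarrow> 'a set set \<Rightarrow> ('a set \<Rightarrow> real) \<Rightarrow> ('a \<Rightarrow> real) set" where
  "core P \<T> c = {y \<in> P \<rightarrow>\<^sub>E {0..}.
     sum y P = min_cover_cost P \<T> c \<and> (\<forall>S\<in>coalitions P. 0 \<le> coalition_excess \<T> c y S)}"

text \<open>
  The infimum below is a minimum: for a set covering instance the linear program is feasible, and
  its entries may be truncated at 1, which leaves a continuous objective on a compact set.
\<close>

definition LP_value :: "'a set \<Rightarrow> 'a set set \<Rightarrow> ('a set \<Rightarrow> real) \<Rightarrow> real" where
  "LP_value P \<T> c = Inf {(\<Sum>T\<in>\<T>. c T * x T) | x.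
     (\<forall>T\<in>\<T>. 0 \<le> x T) \<and> (\<forall>p\<in>P. 1 \<le> (\<Sum>T | T \<in> \<T> \<and> p \<in> T. x T))}"

definition happy_allocations ::
    "'a set \<Rightarrow> 'a set set \<Rightarrow> ('a set \<Rightarrow> real) \<Rightarrow> ('a \<Rightarrow> real) set" where
  "happy_allocations P \<T> c = {y \<in> P \<rightarrow>\<^sub>E {0..}. sum y P = LP_value P \<T> c}"

text \<open>
  All lists compared here have the same length, so that \<^const>\<open>lexordp_eq\<close> is the usual
  lexicographic order on vectors.
\<close>

definition lex_maximizers :: "('b \<Rightarrow> real list) \<Rightarrow> 'b set \<Rightarrow> 'b set" where
  "lex_maximizers f A = {y \<in> A. \<forall>z\<in>A. lexordp_eq (f z) (f y)}"

definition happy_nucleolus ::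
    "'a set \<Rightarrow> 'a set set \<Rightarrow> ('a set \<Rightarrow> real) \<Rightarrow> 'a \<Rightarrow> real" where
  "happy_nucleolus P \<T> c =
     (THE y. y \<in> lex_maximizers (excess_vector P \<T> c) (happy_allocations P \<T> c))"

definition determines_happy_nucleolus ::
    "'a set \<Rightarrow> 'a set set \<Rightarrow> ('a set \<Rightarrow> real) \<Rightarrow> ('a set \<times> 'a set set) set \<Rightarrow> bool" where
  "determines_happy_nucleolus P \<T> c F \<longleftrightarrow>
     lex_maximizers (restricted_excess_vector c F) (happy_allocations P \<T> c)
       = {happy_nucleolus P \<T> c}"

end

theory Submission
  imports Defs
begin

text \<open>
  Let every subset of \<open>P = {0,\<dots>,n-1}\<close> be available, and fix an allocation \<open>y\<^sup>*\<close>. A set \<open>T\<close> costs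
  \<open>y\<^sup>*(T)\<close> plus a surcharge: the sum of weights \<open>e\<^sub>i\<close> over the players \<open>i\<close> that \<open>T\<close> separates from
  player 0. The values \<open>e\<^sub>0, \<dots>, e\<^sub>n\<^sub>-\<^sub>1, y\<^sup>*\<^sub>0, \<dots>, y\<^sup>*\<^sub>n\<^sub>-\<^sub>1\<close> are increasing powers of a large base.

  Nucleolus: if \<open>y \<noteq> y\<^sup>*\<close> and \<open>i \<ge> 1\<close> is minimal with \<open>y\<^sub>i \<noteq> y\<^sup>*\<^sub>i\<close>, then the coalitions whose
  excess under \<open>y\<^sup>*\<close> is below \<open>e\<^sub>i\<close> do not gain, since they are exactly partitioned by sets on which
  \<open>y\<close> and \<open>y\<^sup>*\<close> agree, while \<open>{i}\<close> or its complement drops below \<open>e\<^sub>i\<close>.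

  Lower bound: an excess under \<open>y\<^sup>*\<close> determines its coalition up to complementation. If \<open>F\<close> is small,
  fewer than \<open>n - 1\<close> excess values are attained twice in \<open>F\<close>, so there is \<open>z \<noteq> 0\<close> with \<open>z(P) = 0\<close>
  that vanishes on all coalitions of these values. The lowest value that changes in direction \<open>\<plusminus>z\<close>
  is thus attained only once, and one of the two signs increases it (or no value changes at all), so
  \<open>y\<^sup>*\<close> is not the unique maximizer for \<open>F\<close>.
\<close>

section \<open>Underdetermined homogeneous linear systems\<close>

text \<open>Gaussian elimination, one equation at a time: a zero row is dropped, any other row
  eliminates one variable, which keeps the strict inequality between the two cardinalities.\<close>

lemma homogeneous_system_nonzero_solution:
  fixes a :: "'k \<Rightarrow> 'i \<Rightarrow> real"
  assumes "finite K" "finite I" "card K < card I"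
  shows "\<exists>z. (\<exists>i\<in>I. z i \<noteq> 0) \<and> (\<forall>k\<in>K. (\<Sum>i\<in>I. a k i * z i) = 0)"
  using assms
proof (induction K arbitrary: I a rule: finite_induct)
  case empty
  then have "I \<noteq> {}"
    by auto
  then show ?case
    by (intro exI[of _ "\<lambda>_. 1"]) auto
next
  case (insert k K)
  show ?case
  proof (cases "\<forall>i\<in>I. a k i = 0")
    case True
    have "card K < card I"
      using insert by simp
    from insert.IH[OF insert.prems(1) this, of a] True show ?thesis
      by auto
  next
    case False
    then obtain j where j: "j \<in> I" "a k j \<noteq> 0"
      by blast
    \<comment> \<open>Row \<open>l\<close> minus the multiple of row \<open>k\<close> that makes its
      entry at \<open>j\<close> vanish.\<close>
    define a' where "a' = (\<lambda>l i. a l i - a l j * a k i / a k j)"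
    have "card K < card (I - {j})"
      using insert j by (simp add: card_Diff_singleton)
    from insert.IH[OF _ this, of a'] insert.prems(1)
    obtain z where z: "\<exists>i\<in>I - {j}. z i \<noteq> 0"
      "\<And>l. l \<in> K \<Longrightarrow> (\<Sum>i\<in>I - {j}. a' l i * z i) = 0"
      by auto
    define s where "s = (\<Sum>i\<in>I - {j}. a k i * z i)"
    \<comment> \<open>The value at \<open>j\<close> is the one forced by equation
      \<open>k\<close>.\<close>
    define w where "w = z(j := - s / a k j)"
    have split: "(\<Sum>i\<in>I. a l i * w i) = (\<Sum>i\<in>I - {j}. a l i * z i) - a l j * s / a k j" for l
    proof -
      have "(\<Sum>i\<in>I. a l i * w i) = a l j * w j + (\<Sum>i\<in>I - {j}. a l i * w i)"
        using insert.prems(1) j(1) by (rule sum.remove)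
      also have "(\<Sum>i\<in>I - {j}. a l i * w i) = (\<Sum>i\<in>I - {j}. a l i * z i)"
        by (rule sum.cong) (auto simp: w_def)
      finally show ?thesis
        by (simp add: w_def)
    qed
    have "(\<Sum>i\<in>I. a l i * w i) = 0" if "l \<in> K" for l
    proof -
      have "(\<Sum>i\<in>I - {j}. a' l i * z i) =
          (\<Sum>i\<in>I - {j}. a l i * z i - a l j / a k j * (a k i * z i))"
        by (rule sum.cong) (auto simp: a'_def algebra_simps)
      also have "\<dots> = (\<Sum>i\<in>I - {j}. a l i * z i) - a l j / a k j * s"
        by (simp add: sum_subtractf s_def sum_distrib_left)
      finally show ?thesis
        using z(2)[OF that] split[of l] by simp
    qed
    moreover have "(\<Sum>i\<in>I. a k i * w i) = 0"
      using split[of k] j by (simp add: s_def)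
    moreover have "\<exists>i\<in>I. w i \<noteq> 0"
      using z(1) by (auto simp: w_def)
    ultimately show ?thesis
      by auto
  qed
qed

lemma nonzero_vector_vanishing_on_sets:
  assumes "finite I" "finite Q" "card Q < card I" "\<And>S. S \<in> Q \<Longrightarrow> S \<subseteq> I"
  shows "\<exists>z :: 'i \<Rightarrow> real. (\<exists>i\<in>I. z i \<noteq> 0) \<and> (\<forall>S\<in>Q. sum z S = 0)"
proof -
  have *: "(\<Sum>i\<in>I. of_bool (i \<in> S) * z i) = sum z S" if "S \<in> Q" for z :: "'i \<Rightarrow> real" and S
  proof -
    have "(\<Sum>i\<in>S. z i) = (\<Sum>i\<in>I. of_bool (i \<in> S) * z i)"
      by (rule sum.mono_neutral_cong_left) (use assms that in auto)
    then show ?thesis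
      by simp
  qed
  show ?thesis
    using homogeneous_system_nonzero_solution[of Q I "\<lambda>S i. of_bool (i \<in> S)"] assms(1-3) *
    by auto
qed

section \<open>Repeated values and base expansions\<close>

lemma repeated_values_subset: "{v. 2 \<le> card {q \<in> F. f q = v}} \<subseteq> f ` F"
proof
  fix v assume "v \<in> {v. 2 \<le> card {q \<in> F. f q = v}}"
  then have "card {q \<in> F. f q = v} \<noteq> 0"
    by simp
  then show "v \<in> f ` F"
    by (metis (mono_tags, lifting) card.empty empty_Collect_eq imageI)
qed

text \<open>The fibres over these values are disjoint subsets of \<open>F\<close> with at least two
  elements each.\<close>

lemma card_repeated_values:
  assumes "finite F"
  shows "2 * card {v. 2 \<le> card {q \<in> F. f q = v}} \<le> card F"
proof -
  let ?V = "{v. 2 \<le> card {q \<in> F. f q = v}}"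
  have fin: "finite ?V"
    using assms repeated_values_subset[of F f] by (rule finite_surj)
  have "2 * card ?V = (\<Sum>v\<in>?V. 2)"
    by simp
  also have "\<dots> \<le> (\<Sum>v\<in>?V. card {q \<in> F. f q = v})"
    by (rule sum_mono) simp
  also have "\<dots> = card (\<Union>v\<in>?V. {q \<in> F. f q = v})"
    by (rule card_UN_disjoint[symmetric]) (use fin assms in auto)
  also have "\<dots> \<le> card F"
    by (rule card_mono) (use assms in auto)
  finally show ?thesis .
qed

text \<open>Reduction modulo \<open>b\<close> recovers the lowest digit; cancelling it and dividing
  by \<open>b\<close> shifts the others down.\<close>

lemma digits_unique:
  fixes f g :: "nat \<Rightarrow> nat"
  assumes "(\<Sum>k<N. f k * b ^ k) = (\<Sum>k<N. g k * b ^ k)"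
    and "\<And>k. k < N \<Longrightarrow> f k < b" "\<And>k. k < N \<Longrightarrow> g k < b" "k < N"
  shows "f k = g k"
  using assms
proof (induction N arbitrary: f g k)
  case 0
  then show ?case by simp
next
  case (Suc N)
  have split: "(\<Sum>k<Suc N. h k * b ^ k) = h 0 + b * (\<Sum>k<N. h (Suc k) * b ^ k)"
    for h :: "nat \<Rightarrow> nat"
    unfolding sum.lessThan_Suc_shift by (simp add: sum_distrib_left ac_simps)
  have eq: "f 0 + b * (\<Sum>k<N. f (Suc k) * b ^ k) = g 0 + b * (\<Sum>k<N. g (Suc k) * b ^ k)"
    using Suc.prems(1) unfolding split .
  have lt: "f 0 < b" "g 0 < b"
    using Suc.prems by auto
  have 0: "f 0 = g 0"
    using arg_cong[OF eq, of "\<lambda>x. x mod b"] lt by simp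
  with eq lt have "(\<Sum>k<N. f (Suc k) * b ^ k) = (\<Sum>k<N. g (Suc k) * b ^ k)"
    by simp
  from Suc.IH[OF this] Suc.prems(2,3) have "f (Suc j) = g (Suc j)" if "j < N" for j
    using that by simp
  with 0 Suc.prems(4) show ?case
    by (cases k) auto
qed

section \<open>Lexicographic comparison of sorted vectors\<close>

lemma sorted_values_remove_min:
  assumes "finite I" "j \<in> I" "\<And>i. i \<in> I \<Longrightarrow> f j \<le> f i"
  shows "sorted_values f I = f j # sorted_values f (I - {j})"
proof -
  have "mset_set I = add_mset j (mset_set (I - {j}))"
    using assms(1,2) by (simp add: mset_set.remove)
  moreover have "insort (f j) xs = f j # xs" if "\<forall>x\<in>set xs. f j \<le> x" for xs
    using that by (cases xs) auto
  ultimately show ?thesis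
    using assms by (auto simp: sorted_values_def)
qed

text \<open>The common criterion for both halves of the argument: below the threshold
  \<open>t\<close> nothing of \<open>g\<close> gets larger under \<open>f\<close>, and
  \<open>i0\<close> newly drops below \<open>t\<close>. Equal minima are stripped until the minimum
  of \<open>f\<close> is strictly smaller.\<close>

lemma lexordp_sorted_values:
  assumes "finite I" "\<And>i. \<lbrakk>i \<in> I; g i < t\<rbrakk> \<Longrightarrow> f i \<le> g i"
    and "i0 \<in> I" "f i0 < t" "t \<le> g i0"
  shows "ord_class.lexordp (sorted_values f I) (sorted_values g I)"
  using assms
proof (induction "card I" arbitrary: I rule: less_induct)
  case less
  obtain i where i: "i \<in> I" "\<And>k. k \<in> I \<Longrightarrow> f i \<le> f k"
    using arg_min_if_finite[of I f] less.prems
    by (metis empty_iff linorder_not_less)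
  obtain j where j: "j \<in> I" "\<And>k. k \<in> I \<Longrightarrow> g j \<le> g k"
    using arg_min_if_finite[of I g] less.prems
    by (metis empty_iff linorder_not_less)
  note remove_f = sorted_values_remove_min[OF less.prems(1), of _ f]
  note remove_g = sorted_values_remove_min[OF less.prems(1), of j g, OF j]
  show ?case
  proof (cases "f i < g j")
    case True
    then show ?thesis
      using remove_f[of i, OF i] remove_g by simp
  next
    case False
    \<comment> \<open>Here \<open>g j \<le> f i \<le> f i0 < t\<close>, so index \<open>j\<close>
      attains both minima with the same value and can be removed from both vectors;
      \<open>i0\<close> survives because \<open>g i0\<close> is not below \<open>t\<close>.\<close>
    have "g j < t"
      using False i(2)[OF less.prems(3)] less.prems(4) by linarith
    then have fj: "f j = g j" "j \<noteq> i0"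
      using False i(2)[OF j(1)] less.prems(2)[OF j(1)] less.prems(5) by auto
    then have min: "f j \<le> f k" if "k \<in> I" for k
      using i(2)[OF that] False by linarith
    have "card (I - {j}) < card I"
      using less.prems(1) j(1) by (rule card_Diff1_less)
    then have "ord_class.lexordp (sorted_values f (I - {j})) (sorted_values g (I - {j}))"
      by (rule less.hyps) (use less.prems fj in auto)
    then show ?thesis
      using remove_f[of j, OF j(1) min] remove_g fj by simp
  qed
qed

lemma lex_maximizers_eq_singleton:
  assumes "x \<in> A" "\<And>y. \<lbrakk>y \<in> A; y \<noteq> x\<rbrakk> \<Longrightarrow> ord_class.lexordp (f y) (f x)"
  shows "lex_maximizers f A = {x}"
proof -
  have "lexordp_eq (f y) (f x)" if "y \<in> A" for y
    using assms(2)[OF that] by (cases "y = x") (auto simp: lexordp_eq_refl lexordp_into_lexordp_eq)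
  moreover have "\<not> lexordp_eq (f x) (f y)" if "y \<in> A" "y \<noteq> x" for y
    using assms(2)[OF that] by (simp add: lexordp_conv_lexordp_eq)
  ultimately show ?thesis
    using assms(1) by (auto simp: lex_maximizers_def)
qed

lemma finite_covering_pairs:
  assumes "finite P" "finite \<T>"
  shows "finite (covering_pairs P \<T>)"
  by (rule finite_subset[of _ "Pow P \<times> Pow \<T>"])
    (use assms in \<open>auto simp: covering_pairs_def coalitions_def\<close>)

lemma coalition_excess_le:
  assumes "finite \<T>" "\<U> \<subseteq> \<T>" "covers \<U> S"
  shows "coalition_excess \<T> c y S \<le> excess c y (S, \<U>)"
  unfolding coalition_excess_def by (rule Min_le) (use assms in auto)

lemma coalition_excess_attained:
  assumes "finite \<T>" "covers \<T> S"
  obtains \<U> where "\<U> \<subseteq> \<T>" "covers \<U> S" "coalition_excess \<T> c y S = excess c y (S, \<U>)"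
proof -
  have "coalition_excess \<T> c y S \<in> {excess c y (S, \<U>) | \<U>. \<U> \<subseteq> \<T> \<and> covers \<U> S}"
    unfolding coalition_excess_def by (rule Min_in) (use assms in auto)
  then show ?thesis
    using that by blast
qed

section \<open>The instance and its excess formula\<close>

context
  fixes n :: nat
begin

text \<open>A family of subsets has at most \<open>2 ^ n\<close> members, so every count of its
  members is an admissible digit.\<close>

definition base :: nat where
  "base = 2 ^ n + 1"

definition alloc :: "nat \<Rightarrow> real" where
  "alloc = (\<lambda>p\<in>{..<n}. real (base ^ (n + p)))"

text \<open>Invariant under complementation within \<open>{..<n}\<close>; in particular, the empty
  and the grand coalition carry no surcharge.\<close>

definition surcharge :: "nat set \<Rightarrow> real" where
  "surcharge T = (\<Sum>i | i < n \<and> (0 \<in> T) \<noteq> (i \<in> T). real (base ^ i))"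

definition cost :: "nat set \<Rightarrow> real" where
  "cost T = sum alloc T + surcharge T"

definition multiplicity :: "nat set set \<Rightarrow> nat \<Rightarrow> nat" where
  "multiplicity \<U> p = card {T \<in> \<U>. p \<in> T}"

definition separation :: "nat set set \<Rightarrow> nat \<Rightarrow> nat" where
  "separation \<U> p = card {T \<in> \<U>. (0 \<in> T) \<noteq> (p \<in> T)}"

lemma alloc_ge_power: "p < n \<Longrightarrow> i < n \<Longrightarrow> real (base ^ i) \<le> alloc p"
  unfolding alloc_def by (auto simp: base_def intro: power_increasing)

lemma alloc_ge_1: "p < n \<Longrightarrow> 1 \<le> alloc p"
  unfolding alloc_def by (auto simp: base_def)

lemma surcharge_nonneg: "0 \<le> surcharge T"
  unfolding surcharge_def by (rule sum_nonneg) simp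

lemma alloc_sum_nonneg: "T \<subseteq> {..<n} \<Longrightarrow> 0 \<le> sum alloc T"
  using alloc_ge_1 by (intro sum_nonneg) (meson lessThan_iff subsetD zero_le_one order_trans)

text \<open>The sets separating 0 from \<open>p\<close> form the symmetric difference of those
  containing 0 and those containing \<open>p\<close>.\<close>

lemma separation_parity:
  assumes "finite \<U>"
  shows "even (separation \<U> p) \<longleftrightarrow> even (multiplicity \<U> 0 + multiplicity \<U> p)"
proof -
  let ?A = "{T \<in> \<U>. 0 \<in> T}" and ?B = "{T \<in> \<U>. p \<in> T}"
  have "{T \<in> \<U>. (0 \<in> T) \<noteq> (p \<in> T)} = (?A - ?B) \<union> (?B - ?A)"
    by auto
  then have "separation \<U> p = card (?A - ?B) + card (?B - ?A)"
    unfolding separation_def using assms by (simp add: card_Un_disjoint disjoint_iff)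
  moreover have "card ?A = card (?A - ?B) + card (?A \<inter> ?B)"
    "card ?B = card (?B - ?A) + card (?A \<inter> ?B)"
    using assms by (auto simp: card_Diff_subset_Int Int_commute card_mono)
  ultimately show ?thesis
    unfolding multiplicity_def by presburger
qed

lemma sum_of_subset_as_lessThan_sum:
  assumes "S \<subseteq> {..<n}"
  shows "sum y S = (\<Sum>p<n. of_bool (p \<in> S) * (y p :: real))"
  by (rule sum.mono_neutral_cong_left) (use assms in auto)

text \<open>Double counting of pairs of a set and one of its players.\<close>

lemma sum_of_sums_by_multiplicity:
  fixes y :: "nat \<Rightarrow> real"
  assumes "\<U> \<subseteq> Pow {..<n}"
  shows "(\<Sum>T\<in>\<U>. sum y T) = (\<Sum>p<n. real (multiplicity \<U> p) * y p)"
proof -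
  have fin: "finite \<U>"
    using assms finite_subset by blast
  have "(\<Sum>T\<in>\<U>. sum y T) = (\<Sum>T\<in>\<U>. \<Sum>p<n. of_bool (p \<in> T) * y p)"
    using assms by (intro sum.cong sum_of_subset_as_lessThan_sum) auto
  also have "\<dots> = (\<Sum>p<n. (\<Sum>T\<in>\<U>. of_bool (p \<in> T)) * y p)"
    by (subst sum.swap) (simp add: sum_distrib_right)
  also have "\<dots> = (\<Sum>p<n. real (multiplicity \<U> p) * y p)"
    using fin by (simp add: multiplicity_def Int_def)
  finally show ?thesis .
qed

lemma sum_surcharge:
  assumes "finite \<U>"
  shows "sum surcharge \<U> = (\<Sum>i<n. real (separation \<U> i) * real (base ^ i))"
proof -
  have "sum surcharge \<U> = (\<Sum>T\<in>\<U>. \<Sum>i<n. of_bool ((0 \<in> T) \<noteq> (i \<in> T)) * real (base ^ i))"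
    unfolding surcharge_def
    by (intro sum.cong refl sum.mono_neutral_cong_left) auto
  also have "\<dots> = (\<Sum>i<n. (\<Sum>T\<in>\<U>. of_bool ((0 \<in> T) \<noteq> (i \<in> T))) * real (base ^ i))"
    by (subst sum.swap) (simp add: sum_distrib_right)
  also have "\<dots> = (\<Sum>i<n. real (separation \<U> i) * real (base ^ i))"
    using assms by (simp add: separation_def Int_def)
  finally show ?thesis .
qed

text \<open>Splits the excess into the price of covering beyond \<open>S\<close> and the surcharges.
  For a cover, both are nonnegative.\<close>

lemma excess_alloc:
  assumes "S \<subseteq> {..<n}" "\<U> \<subseteq> Pow {..<n}"
  shows "excess cost alloc (S, \<U>) =
    (\<Sum>p<n. (real (multiplicity \<U> p) - of_bool (p \<in> S)) * alloc p) + sum surcharge \<U>"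
  unfolding excess_def prod.case cost_def sum.distrib sum_of_sums_by_multiplicity[OF assms(2)]
    sum_of_subset_as_lessThan_sum[OF assms(1)]
  by (simp add: left_diff_distrib sum_subtractf)

lemma multiplicity_ge_if_covers:
  assumes "finite \<U>" "covers \<U> S"
  shows "of_bool (p \<in> S) \<le> multiplicity \<U> p"
proof (cases "p \<in> S")
  case True
  then have "{T \<in> \<U>. p \<in> T} \<noteq> {}"
    using assms(2) by (auto simp: covers_def)
  then have "0 < card {T \<in> \<U>. p \<in> T}"
    using assms(1) by (simp add: card_gt_0_iff)
  then show ?thesis
    using True by (simp add: multiplicity_def)
qed simp

lemma excess_alloc_terms_nonneg:
  assumes "finite \<U>" "covers \<U> S" "p < n"
  shows "0 \<le> (real (multiplicity \<U> p) - of_bool (p \<in> S)) * alloc p"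
  using multiplicity_ge_if_covers[OF assms(1,2), of p] alloc_ge_1[OF assms(3)]
  by (intro mult_nonneg_nonneg) (auto split: if_splits simp: of_bool_def)

lemma excess_alloc_nonneg:
  assumes "S \<subseteq> {..<n}" "\<U> \<subseteq> Pow {..<n}" "covers \<U> S"
  shows "0 \<le> excess cost alloc (S, \<U>)"
proof -
  have "finite \<U>"
    using assms finite_subset by blast
  then show ?thesis
    unfolding excess_alloc[OF assms(1,2)] using excess_alloc_terms_nonneg assms(3)
    by (auto intro!: add_nonneg_nonneg sum_nonneg surcharge_nonneg)
qed

section \<open>Excess values as digit expansions\<close>

text \<open>The subtraction of naturals does not truncate when \<open>\<U>\<close> covers
  \<open>S\<close>, since then every player of \<open>S\<close> has positive multiplicity.\<close>

definition excess_digit :: "nat set \<times> nat set set \<Rightarrow> nat \<Rightarrow> nat" where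
  "excess_digit = (\<lambda>(S, \<U>) k.
     if k < n then separation \<U> k else multiplicity \<U> (k - n) - of_bool (k - n \<in> S))"

lemma excess_alloc_digits:
  assumes "S \<subseteq> {..<n}" "\<U> \<subseteq> Pow {..<n}" "covers \<U> S"
  shows "excess cost alloc (S, \<U>) = real (\<Sum>k<n + n. excess_digit (S, \<U>) k * base ^ k)"
proof -
  have fin: "finite \<U>"
    using assms finite_subset by blast
  have split: "(\<Sum>k<n + m. f k) = (\<Sum>k<n. f k) + (\<Sum>k<m. f (n + k))" for m and f :: "nat \<Rightarrow> nat"
    by (induction m) auto
  have "real (\<Sum>p<n. excess_digit (S, \<U>) (n + p) * base ^ (n + p)) =
      (\<Sum>p<n. (real (multiplicity \<U> p) - of_bool (p \<in> S)) * alloc p)"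
    unfolding of_nat_sum
  proof (rule sum.cong)
    fix p assume "p \<in> {..<n}"
    then show "real (excess_digit (S, \<U>) (n + p) * base ^ (n + p)) =
        (real (multiplicity \<U> p) - of_bool (p \<in> S)) * alloc p"
      using multiplicity_ge_if_covers[OF fin assms(3), of p]
      by (simp add: excess_digit_def alloc_def of_nat_diff)
  qed simp
  moreover have "real (\<Sum>i<n. excess_digit (S, \<U>) i * base ^ i) = sum surcharge \<U>"
    unfolding sum_surcharge[OF fin] by (simp add: excess_digit_def)
  ultimately show ?thesis
    unfolding excess_alloc[OF assms(1,2)] split of_nat_add by simp
qed

lemma excess_digit_less_base:
  assumes "\<U> \<subseteq> Pow {..<n}"
  shows "excess_digit (S, \<U>) k < base"
proof -
  have fin: "finite \<U>"
    using assms finite_subset by blast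
  have "card {T \<in> \<U>. Q T} < base" for Q
  proof -
    have "card {T \<in> \<U>. Q T} \<le> card (Pow {..<n})"
      by (rule card_mono) (use assms in auto)
    then show ?thesis
      by (simp add: base_def card_Pow)
  qed
  from this[of "\<lambda>T. (0 \<in> T) \<noteq> (k \<in> T)"] this[of "\<lambda>T. k - n \<in> T"] show ?thesis
    by (auto simp: excess_digit_def separation_def multiplicity_def intro: le_less_trans)
qed

text \<open>
  The upper digits of the excess give membership in \<open>S\<close> up to the parities of the multiplicities;
  the lower digits give these parities up to that of player 0.
\<close>

lemma equal_excess_imp_equal_or_complement:
  assumes "q \<in> covering_pairs {..<n} (Pow {..<n})" "q' \<in> covering_pairs {..<n} (Pow {..<n})"
    and "excess cost alloc q = excess cost alloc q'"
  shows "fst q' = fst q \<or> fst q' = {..<n} - fst q"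
proof -
  obtain S \<U> S' \<U>' where q: "q = (S, \<U>)" "q' = (S', \<U>')"
    by (meson surj_pair)
  have S: "S \<subseteq> {..<n}" "\<U> \<subseteq> Pow {..<n}" "covers \<U> S"
    and S': "S' \<subseteq> {..<n}" "\<U>' \<subseteq> Pow {..<n}" "covers \<U>' S'"
    using assms(1,2) q by (auto simp: covering_pairs_def coalitions_def)
  have fin: "finite \<U>" "finite \<U>'"
    using S(2) S'(2) finite_subset by blast+
  have "(\<Sum>k<n + n. excess_digit (S, \<U>) k * base ^ k) =
      (\<Sum>k<n + n. excess_digit (S', \<U>') k * base ^ k)"
    using assms(3) unfolding q excess_alloc_digits[OF S] excess_alloc_digits[OF S'] of_nat_eq_iff .
  then have digit: "excess_digit (S, \<U>) k = excess_digit (S', \<U>') k" if "k < n + n" for k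
    by (rule digits_unique) (use that S(2) S'(2) in \<open>auto intro: excess_digit_less_base\<close>)
  have sep: "separation \<U> p = separation \<U>' p" if "p < n" for p
    using digit[of p] that by (simp add: excess_digit_def)
  have mult: "multiplicity \<U> p - of_bool (p \<in> S) = multiplicity \<U>' p - of_bool (p \<in> S')"
    if "p < n" for p
    using digit[of "n + p"] that by (simp add: excess_digit_def)
  \<comment> \<open>Equal surpluses mean that the multiplicities differ by exactly the difference in
    membership.\<close>
  have mem: "(p \<in> S) = (p \<in> S') \<longleftrightarrow> even (multiplicity \<U> p + multiplicity \<U>' p)" if "p < n" for p
    using mult[OF that] multiplicity_ge_if_covers[OF fin(1) S(3), of p]
      multiplicity_ge_if_covers[OF fin(2) S'(3), of p]
    by (cases "p \<in> S"; cases "p \<in> S'") (simp_all, presburger+)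
  have parity: "(p \<in> S) = (p \<in> S') \<longleftrightarrow> (0 \<in> S) = (0 \<in> S')" if "p < n" for p
    using sep[OF that] separation_parity[OF fin(1), of p] separation_parity[OF fin(2), of p]
      mem[OF that] mem[of 0] that by auto
  show ?thesis
    unfolding q fst_conv using parity S(1) S'(1) by (cases "(0 \<in> S) = (0 \<in> S')") blast+
qed

section \<open>LP value and core\<close>

lemma cost_ge_alloc_sum: "sum alloc T \<le> cost T"
  by (simp add: cost_def surcharge_nonneg)

lemma cost_nonneg: "T \<subseteq> {..<n} \<Longrightarrow> 0 \<le> cost T"
  using alloc_sum_nonneg cost_ge_alloc_sum order_trans by blast

lemma cost_grand_coalition: "cost {..<n} = sum alloc {..<n}"
proof -
  have "{i. i < n \<and> (0 \<in> {..<n}) \<noteq> (i \<in> {..<n})} = {}"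
    by auto
  then show ?thesis
    unfolding cost_def surcharge_def by (simp only: sum.empty add_0_right)
qed

text \<open>Weak duality: \<open>alloc\<close> is dual feasible as no set costs less than its
  allocation, and buying the grand coalition, which has no surcharge, attains the bound.\<close>

lemma LP_value_eq: "LP_value {..<n} (Pow {..<n}) cost = sum alloc {..<n}"
  unfolding LP_value_def
proof (rule cInf_eq_minimum)
  let ?x = "\<lambda>T. of_bool (T = {..<n}) :: real"
  have "(\<Sum>T\<in>Pow {..<n}. cost T * ?x T) = (\<Sum>T\<in>{{..<n}}. cost T)"
    by (rule sum.mono_neutral_cong_right) auto
  then have "sum alloc {..<n} = (\<Sum>T\<in>Pow {..<n}. cost T * ?x T)"
    by (simp only: cost_grand_coalition sum.insert finite.emptyI empty_iff sum.empty add_0_right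
        not_False_eq_True)
  moreover have "(\<Sum>T | T \<in> Pow {..<n} \<and> p \<in> T. ?x T) = (\<Sum>T\<in>{{..<n}}. 1)" if "p \<in> {..<n}" for p
    by (rule sum.mono_neutral_cong_right) (use that in auto)
  then have "\<forall>p\<in>{..<n}. 1 \<le> (\<Sum>T | T \<in> Pow {..<n} \<and> p \<in> T. ?x T)"
    by simp
  moreover have "\<forall>T\<in>Pow {..<n}. 0 \<le> ?x T"
    by simp
  ultimately show "sum alloc {..<n} \<in> {(\<Sum>T\<in>Pow {..<n}. cost T * x T) | x. (\<forall>T\<in>Pow {..<n}. 0 \<le> x T) \<and>
      (\<forall>p\<in>{..<n}. 1 \<le> (\<Sum>T | T \<in> Pow {..<n} \<and> p \<in> T. x T))}"
    by (intro CollectI exI[of _ ?x] conjI)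
next
  fix v
  assume "v \<in> {(\<Sum>T\<in>Pow {..<n}. cost T * x T) | x. (\<forall>T\<in>Pow {..<n}. 0 \<le> x T) \<and>
      (\<forall>p\<in>{..<n}. 1 \<le> (\<Sum>T | T \<in> Pow {..<n} \<and> p \<in> T. x T))}"
  then obtain x where x: "v = (\<Sum>T\<in>Pow {..<n}. cost T * x T)" "\<And>T. T \<subseteq> {..<n} \<Longrightarrow> 0 \<le> x T"
    "\<And>p. p < n \<Longrightarrow> 1 \<le> (\<Sum>T | T \<in> Pow {..<n} \<and> p \<in> T. x T)"
    by auto
  have "sum alloc {..<n} \<le> (\<Sum>p<n. alloc p * (\<Sum>T | T \<in> Pow {..<n} \<and> p \<in> T. x T))"
  proof (rule sum_mono)
    fix p assume "p \<in> {..<n}"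
    then show "alloc p \<le> alloc p * (\<Sum>T | T \<in> Pow {..<n} \<and> p \<in> T. x T)"
      using mult_left_mono[OF x(3), of p "alloc p"] alloc_ge_1[of p] by simp
  qed
  also have "\<dots> = (\<Sum>p<n. \<Sum>T\<in>Pow {..<n}. of_bool (p \<in> T) * alloc p * x T)"
    unfolding sum_distrib_left
    by (intro sum.cong refl sum.mono_neutral_cong_left) auto
  also have "\<dots> = (\<Sum>T\<in>Pow {..<n}. (\<Sum>p<n. of_bool (p \<in> T) * alloc p) * x T)"
    by (subst sum.swap) (simp only: sum_distrib_right)
  also have "\<dots> = (\<Sum>T\<in>Pow {..<n}. sum alloc T * x T)"
    by (intro sum.cong refl arg_cong2[of _ _ _ _ "(*)"] sum_of_subset_as_lessThan_sum[symmetric])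
      auto
  also have "\<dots> \<le> v"
    unfolding x(1) using x(2) cost_ge_alloc_sum by (intro sum_mono mult_right_mono) auto
  finally show "sum alloc {..<n} \<le> v" .
qed

lemma min_cover_cost_eq: "min_cover_cost {..<n} (Pow {..<n}) cost = sum alloc {..<n}"
  unfolding min_cover_cost_def
proof (rule Min_eqI)
  show "sum alloc {..<n} \<in> {sum cost \<U> | \<U>. \<U> \<subseteq> Pow {..<n} \<and> covers \<U> {..<n}}"
    using cost_grand_coalition by (intro CollectI exI[of _ "{{..<n}}"]) (auto simp: covers_def)
next
  fix v assume "v \<in> {sum cost \<U> | \<U>. \<U> \<subseteq> Pow {..<n} \<and> covers \<U> {..<n}}"
  then show "sum alloc {..<n} \<le> v"
    using excess_alloc_nonneg by (auto simp: excess_def)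
qed auto

lemma alloc_in_happy_allocations: "alloc \<in> happy_allocations {..<n} (Pow {..<n}) cost"
  using alloc_ge_1 by (fastforce simp: happy_allocations_def LP_value_eq alloc_def)

lemma covers_Pow: "S \<in> coalitions {..<n} \<Longrightarrow> covers (Pow {..<n}) S"
  by (auto simp: coalitions_def covers_def)

lemma alloc_in_core: "alloc \<in> core {..<n} (Pow {..<n}) cost"
proof -
  have "0 \<le> coalition_excess (Pow {..<n}) cost alloc S" if S: "S \<in> coalitions {..<n}" for S
  proof -
    obtain \<U> where "\<U> \<subseteq> Pow {..<n}" "covers \<U> S"
      "coalition_excess (Pow {..<n}) cost alloc S = excess cost alloc (S, \<U>)"
      by (rule coalition_excess_attained[of "Pow {..<n}" S cost alloc])
        (use covers_Pow[OF S] in auto)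
    then show ?thesis
      using excess_alloc_nonneg S by (auto simp: coalitions_def)
  qed
  then show ?thesis
    using alloc_in_happy_allocations
    by (simp add: core_def happy_allocations_def LP_value_eq min_cover_cost_eq)
qed

section \<open>The happy nucleolus is \<open>alloc\<close>\<close>

text \<open>So small an excess pays neither for covering a player beyond \<open>S\<close> nor for
  separating a player \<open>j \<ge> i\<close> from 0. Hence \<open>\<U>\<close> partitions
  \<open>S\<close>, and each of its sets or the complement of that set lies in
  \<open>{1..<i}\<close>.\<close>

lemma sum_eq_alloc_if_excess_less:
  assumes S: "S \<subseteq> {..<n}" "\<U> \<subseteq> Pow {..<n}" "covers \<U> S"
    and i: "i < n" "excess cost alloc (S, \<U>) < real (base ^ i)"
    and y: "sum y {..<n} = sum alloc {..<n}" "\<And>j. \<lbrakk>1 \<le> j; j < i\<rbrakk> \<Longrightarrow> y j = alloc j"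
  shows "sum y S = sum alloc S"
proof -
  have fin: "finite \<U>"
    using S finite_subset by blast
  let ?d = "\<lambda>p. (real (multiplicity \<U> p) - of_bool (p \<in> S)) * alloc p"
  have nonneg: "0 \<le> ?d p" if "p < n" for p
    using excess_alloc_terms_nonneg[OF fin S(3) that] .
  have small: "(\<Sum>p<n. ?d p) < real (base ^ i)" "sum surcharge \<U> < real (base ^ i)"
    using i(2) nonneg unfolding excess_alloc[OF S(1,2)]
    by (smt (verit, best) lessThan_iff sum_nonneg surcharge_nonneg)+
  have mult: "real (multiplicity \<U> p) = of_bool (p \<in> S)" if p: "p < n" for p
  proof (rule ccontr)
    assume "real (multiplicity \<U> p) \<noteq> of_bool (p \<in> S)"
    then have "1 \<le> real (multiplicity \<U> p) - of_bool (p \<in> S)"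
      using multiplicity_ge_if_covers[OF fin S(3), of p] by (cases "p \<in> S") auto
    then have "alloc p \<le> ?d p"
      using mult_right_mono[of 1 "real (multiplicity \<U> p) - of_bool (p \<in> S)" "alloc p"]
        alloc_ge_1[OF p] by simp
    also have "\<dots> \<le> (\<Sum>p<n. ?d p)"
      by (rule member_le_sum) (use p nonneg in auto)
    finally show False
      using small(1) alloc_ge_power[OF p i(1)] by linarith
  qed
  have partition: "(\<Sum>T\<in>\<U>. sum w T) = sum w S" for w :: "nat \<Rightarrow> real"
    unfolding sum_of_sums_by_multiplicity[OF S(2)] sum_of_subset_as_lessThan_sum[OF S(1)]
    by (rule sum.cong) (use mult in auto)
  have "sum y T = sum alloc T" if T: "T \<in> \<U>" for T
  proof -
    have T_sub: "T \<subseteq> {..<n}"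
      using T S(2) by auto
    have "surcharge T \<le> sum surcharge \<U>"
      by (rule member_le_sum) (use T fin surcharge_nonneg in auto)
    then have less: "surcharge T < real (base ^ i)"
      using small(2) by linarith
    have same_side: "(0 \<in> T) = (j \<in> T)" if j: "j < n" "i \<le> j" for j
    proof (rule ccontr)
      assume "(0 \<in> T) \<noteq> (j \<in> T)"
      then have "real (base ^ j) \<le> surcharge T"
        unfolding surcharge_def by (intro member_le_sum) (use j in auto)
      moreover have "real (base ^ i) \<le> real (base ^ j)"
        using j(2) by (auto simp: base_def intro: power_increasing)
      ultimately show False
        using less by linarith
    qed
    have agree: "sum y A = sum alloc A" if "A \<subseteq> {1..<i}" for A
      using that y(2) by (intro sum.cong) auto
    show ?thesis
    proof (cases "0 \<in> T")
      case False
      have "T \<subseteq> {1..<i}"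
      proof
        fix j assume j: "j \<in> T"
        then have "j < i"
          using same_side[of j] T_sub False by (meson leI lessThan_iff subsetD)
        moreover have "j \<noteq> 0"
          using j False by metis
        ultimately show "j \<in> {1..<i}"
          by simp
      qed
      then show ?thesis
        by (rule agree)
    next
      case True
      have "{..<n} - T \<subseteq> {1..<i}"
      proof
        fix j assume j: "j \<in> {..<n} - T"
        then have "j < i"
          using same_side[of j] True by (meson DiffE leI lessThan_iff)
        moreover have "j \<noteq> 0"
          using j True by (metis DiffE)
        ultimately show "j \<in> {1..<i}"
          by simp
      qed
      \<comment> \<open>Agreement on the complement transfers to \<open>T\<close> because the totals
        agree.\<close>
      then have "sum y ({..<n} - T) = sum alloc ({..<n} - T)"
        by (rule agree)
      then show ?thesis
        using y(1) T_sub by (simp add: sum_diff)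
    qed
  qed
  then have "(\<Sum>T\<in>\<U>. sum y T) = (\<Sum>T\<in>\<U>. sum alloc T)"
    by (rule sum.cong[OF refl])
  then show ?thesis
    unfolding partition .
qed

lemma alloc_lex_greater:
  assumes y: "y \<in> happy_allocations {..<n} (Pow {..<n}) cost" "y \<noteq> alloc"
  shows "ord_class.lexordp (excess_vector {..<n} (Pow {..<n}) cost y)
    (excess_vector {..<n} (Pow {..<n}) cost alloc)"
proof -
  let ?\<T> = "Pow {..<n}"
  have y_sum: "sum y {..<n} = sum alloc {..<n}" and y_ext: "y \<in> extensional {..<n}"
    using y(1) by (auto simp: happy_allocations_def LP_value_eq PiE_def)
  \<comment> \<open>Two allocations with equal totals cannot differ at player 0 alone.\<close>
  have "\<exists>i. 1 \<le> i \<and> i < n \<and> y i \<noteq> alloc i"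
  proof (rule ccontr)
    assume "\<not> ?thesis"
    then have agree: "y i = alloc i" if "1 \<le> i" "i < n" for i
      using that by blast
    have "y p = alloc p" if p: "p < n" for p
    proof (cases "p = 0")
      case True
      have "sum y ({..<n} - {0}) = sum alloc ({..<n} - {0})"
        by (rule sum.cong) (auto intro: agree)
      then show ?thesis
        using y_sum p True sum.remove[of "{..<n}" 0 y] sum.remove[of "{..<n}" 0 alloc] by simp
    qed (use agree p in auto)
    then have "y = alloc"
      by (intro extensionalityI[OF y_ext, of alloc]) (auto simp: alloc_def)
    with y(2) show False ..
  qed
  then obtain i where i: "1 \<le> i" "i < n" "y i \<noteq> alloc i"
    and "\<And>j. j < i \<Longrightarrow> \<not> (1 \<le> j \<and> j < n \<and> y j \<noteq> alloc j)"
    using exists_least_iff[of "\<lambda>i. 1 \<le> i \<and> i < n \<and> y i \<noteq> alloc i"] by auto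
  then have below: "y j = alloc j" if "1 \<le> j" "j < i" for j
    using that by auto
  have below_threshold: "\<exists>\<U>. \<U> \<subseteq> ?\<T> \<and> covers \<U> S \<and> sum y S = sum alloc S \<and>
      coalition_excess ?\<T> cost alloc S = excess cost alloc (S, \<U>)"
    if S: "S \<in> coalitions {..<n}" "coalition_excess ?\<T> cost alloc S < real (base ^ i)" for S
  proof -
    obtain \<U> where \<U>: "\<U> \<subseteq> ?\<T>" "covers \<U> S"
      "coalition_excess ?\<T> cost alloc S = excess cost alloc (S, \<U>)"
      by (rule coalition_excess_attained[of ?\<T> S cost alloc]) (use covers_Pow S(1) in auto)
    moreover have "sum y S = sum alloc S"
      by (rule sum_eq_alloc_if_excess_less[OF _ \<U>(1,2) i(2) _ y_sum below])
        (use S \<U>(3) in \<open>auto simp: coalitions_def\<close>)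
    ultimately show ?thesis
      by blast
  qed
  have surcharge_i: "surcharge {i} = real (base ^ i)" "surcharge ({..<n} - {i}) = real (base ^ i)"
  proof -
    have "{j. j < n \<and> (0 \<in> {i}) \<noteq> (j \<in> {i})} = {i}"
      "{j. j < n \<and> (0 \<in> {..<n} - {i}) \<noteq> (j \<in> {..<n} - {i})} = {i}"
      using i(1,2) by auto
    then show "surcharge {i} = real (base ^ i)" "surcharge ({..<n} - {i}) = real (base ^ i)"
      unfolding surcharge_def by simp_all
  qed
  \<comment> \<open>Either \<open>{i}\<close> or its complement receives more under
    \<open>y\<close>; both separate only player \<open>i\<close> from 0.\<close>
  obtain S where S: "S \<in> coalitions {..<n}" "surcharge S = real (base ^ i)" "sum alloc S < sum y S"
  proof (cases "alloc i < y i")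
    case True
    then show ?thesis
      using that[of "{i}"] i surcharge_i by (auto simp: coalitions_def)
  next
    case False
    have "sum alloc ({..<n} - {i}) < sum y ({..<n} - {i})"
      using False y_sum i sum.remove[of "{..<n}" i y] sum.remove[of "{..<n}" i alloc] by simp
    moreover have "0 \<in> {..<n} - {i}"
      using i by auto
    ultimately show ?thesis
      using that[of "{..<n} - {i}"] surcharge_i by (auto simp: coalitions_def)
  qed
  show ?thesis
    unfolding excess_vector_def
  proof (rule lexordp_sorted_values[where t = "real (base ^ i)" and ?i0.0 = S])
    show "finite (coalitions {..<n})"
      by (rule finite_subset[of _ ?\<T>]) (auto simp: coalitions_def)
    show "coalition_excess ?\<T> cost y S' \<le> coalition_excess ?\<T> cost alloc S'"
      if S': "S' \<in> coalitions {..<n}" "coalition_excess ?\<T> cost alloc S' < real (base ^ i)" for S'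
      using below_threshold[OF S'] coalition_excess_le[of ?\<T> _ S' cost y] by (auto simp: excess_def)
    show "S \<in> coalitions {..<n}"
      by fact
    \<comment> \<open>Covering \<open>S\<close> by itself costs the surcharge
      \<open>base ^ i\<close> above its allocation, and \<open>y\<close> gives \<open>S\<close>
      strictly more than that allocation.\<close>
    have "coalition_excess ?\<T> cost y S \<le> excess cost y (S, {S})"
      by (rule coalition_excess_le) (use S(1) in \<open>auto simp: coalitions_def covers_def\<close>)
    also have "\<dots> < real (base ^ i)"
      using S(2,3) by (simp add: excess_def cost_def)
    finally show "coalition_excess ?\<T> cost y S < real (base ^ i)" .
    \<comment> \<open>A smaller excess would force \<open>y\<close> and \<open>alloc\<close> to
      agree on \<open>S\<close>.\<close>
    show "real (base ^ i) \<le> coalition_excess ?\<T> cost alloc S"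
      using below_threshold[OF S(1)] S(3) by (cases "coalition_excess ?\<T> cost alloc S < real (base ^ i)") auto
  qed
qed

lemma happy_nucleolus_eq: "happy_nucleolus {..<n} (Pow {..<n}) cost = alloc"
proof -
  have "lex_maximizers (excess_vector {..<n} (Pow {..<n}) cost)
      (happy_allocations {..<n} (Pow {..<n}) cost) = {alloc}"
    by (rule lex_maximizers_eq_singleton) (use alloc_in_happy_allocations alloc_lex_greater in auto)
  then show ?thesis
    by (simp add: happy_nucleolus_def)
qed

section \<open>Lower bound on determining families\<close>

lemma small_family_not_determining:
  assumes F: "F \<subseteq> covering_pairs {..<n} (Pow {..<n})" and small: "card F + 2 < 2 * n"
  shows "\<not> determines_happy_nucleolus {..<n} (Pow {..<n}) cost F"
proof
  let ?e = "excess cost alloc" and ?H = "happy_allocations {..<n} (Pow {..<n}) cost"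
  assume "determines_happy_nucleolus {..<n} (Pow {..<n}) cost F"
  then have max: "lex_maximizers (restricted_excess_vector cost F) ?H = {alloc}"
    by (simp add: determines_happy_nucleolus_def happy_nucleolus_eq)
  have fin: "finite F"
    using F finite_covering_pairs[of "{..<n}" "Pow {..<n}"] finite_subset by auto
  have pair: "fst q \<subseteq> {..<n}" "snd q \<subseteq> Pow {..<n}" "covers (snd q) (fst q)" if "q \<in> F" for q
    using subsetD[OF F that] by (auto simp: covering_pairs_def coalitions_def)

  define V where "V = {v. 2 \<le> card {q \<in> F. ?e q = v}}"
  \<comment> \<open>One coalition per value suffices: any other with the same value is equal or
    complementary to it.\<close>
  define rep where "rep v = fst (SOME q. q \<in> F \<and> ?e q = v)" for v
  have rep: "\<exists>q'\<in>F. ?e q' = ?e q \<and> rep (?e q) = fst q'" if "q \<in> F" for q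
    unfolding rep_def using someI[of "\<lambda>q'. q' \<in> F \<and> ?e q' = ?e q" q] that by blast
  have V: "2 * card V \<le> card F"
    unfolding V_def by (rule card_repeated_values[OF fin])
  have V_image: "V \<subseteq> ?e ` F"
    unfolding V_def by (rule repeated_values_subset)
  have fin_V: "finite V"
    using fin V_image by (rule finite_surj)
  have "card (rep ` V) \<le> card V"
    using fin_V by (rule card_image_le)
  \<comment> \<open>From \<open>2 * card V \<le> card F < 2 * n - 2\<close>, the equations for
    \<open>V\<close> and the one for the total are fewer than \<open>n\<close>.\<close>
  then have card: "card (insert {..<n} (rep ` V)) < card {..<n}"
    using V small fin_V by (simp add: card_insert_if)
  have sub: "rep v \<subseteq> {..<n}" if v: "v \<in> V" for v
  proof -
    obtain q where "q \<in> F" "v = ?e q"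
      using v V_image by blast
    then obtain q' where "q' \<in> F" "rep v = fst q'"
      using rep by blast
    then show ?thesis
      using pair(1) by simp
  qed
  have "\<exists>z :: nat \<Rightarrow> real. (\<exists>p\<in>{..<n}. z p \<noteq> 0) \<and> (\<forall>S\<in>insert {..<n} (rep ` V). sum z S = 0)"
    by (rule nonzero_vector_vanishing_on_sets[OF _ _ card]) (use fin_V sub in auto)
  then obtain z :: "nat \<Rightarrow> real" where z: "\<exists>p<n. z p \<noteq> 0" "sum z {..<n} = 0"
    "\<And>v. v \<in> V \<Longrightarrow> sum z (rep v) = 0"
    by auto
  have z_repeated: "sum z (fst q) = 0" if q: "q \<in> F" "?e q \<in> V" for q
  proof -
    obtain q' where q': "q' \<in> F" "?e q' = ?e q" "rep (?e q) = fst q'"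
      using rep[OF q(1)] by blast
    then have "fst q = fst q' \<or> fst q = {..<n} - fst q'"
      using equal_excess_imp_equal_or_complement[of q' q] F q(1) by auto
    moreover have "sum z (fst q') = 0"
      using z(3)[OF q(2)] q'(3) by simp
    moreover have "sum z ({..<n} - fst q') = sum z {..<n} - sum z (fst q')"
      using pair(1)[OF q'(1)] by (intro sum_diff) auto
    ultimately show ?thesis
      using z(2) by (elim disjE) simp_all
  qed

  define M where "M = (\<Sum>p<n. \<bar>z p\<bar>)"
  have M_ge: "\<bar>sum z S\<bar> \<le> M" if "S \<subseteq> {..<n}" for S
  proof -
    have "\<bar>sum z S\<bar> \<le> (\<Sum>p\<in>S. \<bar>z p\<bar>)"
      by (rule sum_abs)
    also have "\<dots> \<le> M"
      unfolding M_def by (rule sum_mono2) (use that in auto)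
    finally show ?thesis .
  qed
  have M_pos: "0 < M"
  proof -
    obtain p where "p < n" "z p \<noteq> 0"
      using z(1) by blast
    then show ?thesis
      using M_ge[of "{p}"] by simp
  qed

  define shift where "shift \<epsilon> = (\<lambda>p\<in>{..<n}. alloc p + \<epsilon> * z p)" for \<epsilon>
  have excess_shift: "excess cost (shift \<epsilon>) q = ?e q - \<epsilon> * sum z (fst q)" if "q \<in> F" for \<epsilon> q
  proof -
    have "sum (shift \<epsilon>) (fst q) = (\<Sum>p\<in>fst q. alloc p + \<epsilon> * z p)"
      by (rule sum.cong) (use pair(1)[OF that] in \<open>auto simp: shift_def\<close>)
    then show ?thesis
      by (simp add: excess_def case_prod_unfold sum.distrib sum_distrib_left)
  qed
  \<comment> \<open>Entries of \<open>alloc\<close> are at least 1, so a change of at most 1 keeps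
    them nonnegative.\<close>
  have shift_happy: "shift \<epsilon> \<in> ?H" if eps: "\<bar>\<epsilon>\<bar> * M \<le> 1" for \<epsilon>
  proof -
    have "0 \<le> shift \<epsilon> p" if p: "p < n" for p
    proof -
      have "\<bar>\<epsilon> * z p\<bar> \<le> \<bar>\<epsilon>\<bar> * M"
        using M_ge[of "{p}"] p by (simp add: abs_mult mult_left_mono)
      then show ?thesis
        using eps alloc_ge_1[OF p] p by (simp add: shift_def)
    qed
    moreover have "sum (shift \<epsilon>) {..<n} = sum alloc {..<n}"
      using z(2) by (simp add: shift_def sum.distrib flip: sum_distrib_left)
    ultimately show ?thesis
      by (auto simp: happy_allocations_def LP_value_eq shift_def)
  qed
  show False
  proof (cases "\<exists>q\<in>F. sum z (fst q) \<noteq> 0")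
    case False
    define \<epsilon> where "\<epsilon> = 1 / M"
    \<comment> \<open>No excess in \<open>F\<close> changes, so \<open>shift \<epsilon>\<close> is a
      second maximizer.\<close>
    have "restricted_excess_vector cost F (shift \<epsilon>) = restricted_excess_vector cost F alloc"
      unfolding restricted_excess_vector_def sorted_values_def
      by (intro arg_cong[of _ _ sorted_list_of_multiset] image_mset_cong)
        (use False fin excess_shift in auto)
    moreover have "shift \<epsilon> \<in> ?H"
      by (rule shift_happy) (use M_pos in \<open>simp add: \<epsilon>_def\<close>)
    moreover have "alloc \<in> lex_maximizers (restricted_excess_vector cost F) ?H"
      using max by simp
    ultimately have "shift \<epsilon> \<in> lex_maximizers (restricted_excess_vector cost F) ?H"
      by (simp add: lex_maximizers_def)
    then have "shift \<epsilon> = alloc"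
      using max by simp
    then have "shift \<epsilon> p = alloc p" for p
      by simp
    moreover obtain p where "p < n" "z p \<noteq> 0"
      using z(1) by blast
    moreover from this have "shift \<epsilon> p \<noteq> alloc p"
      using M_pos by (simp add: shift_def \<epsilon>_def)
    ultimately show False
      by blast
  next
    case True
    define A where "A = {q \<in> F. sum z (fst q) \<noteq> 0}"
    have "finite A" "A \<noteq> {}"
      using fin True by (auto simp: A_def)
    from arg_min_if_finite[OF this, of ?e] obtain q0 where "q0 \<in> A" "\<not> (\<exists>q\<in>A. ?e q < ?e q0)"
      by blast
    then have q0: "q0 \<in> F" "sum z (fst q0) \<noteq> 0"
      and q0_min: "\<And>q. q \<in> F \<Longrightarrow> sum z (fst q) \<noteq> 0 \<Longrightarrow> ?e q0 \<le> ?e q"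
      unfolding A_def not_less[symmetric] by blast+
    have q0_only: "q = q0" if "q \<in> F" "?e q = ?e q0" for q
    proof (rule ccontr)
      assume "q \<noteq> q0"
      then have "card {q, q0} \<le> card {q \<in> F. ?e q = ?e q0}"
        by (intro card_mono) (use fin that q0(1) in auto)
      then have "?e q0 \<in> V"
        using \<open>q \<noteq> q0\<close> by (simp add: V_def)
      then show False
        using z_repeated q0 by blast
    qed
    \<comment> \<open>Excesses under \<open>alloc\<close> are natural numbers.\<close>
    have gap: "?e q0 + 1 \<le> ?e q" if q: "q \<in> F" "?e q0 < ?e q" for q
    proof -
      have "\<exists>k :: nat. ?e q' = real k" if "q' \<in> F" for q'
        using excess_alloc_digits[OF pair[OF that]] unfolding prod.collapse by (rule exI)
      then obtain k k0 :: nat where "?e q = real k" "?e q0 = real k0"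
        using q(1) q0(1) by meson
      then show ?thesis
        using q(2) by simp
    qed
    \<comment> \<open>The sign raises the excess of \<open>q0\<close>; the size moves every excess
      in \<open>F\<close> by at most 1/2, half of the gap.\<close>
    define \<epsilon> where "\<epsilon> = - sgn (sum z (fst q0)) / (2 * M)"
    have eps_abs: "\<bar>\<epsilon>\<bar> * M = 1 / 2"
      using q0(2) M_pos by (simp add: \<epsilon>_def abs_sgn_eq)
    have "\<epsilon> * sum z (fst q0) = - (\<bar>sum z (fst q0)\<bar> / (2 * M))"
      by (simp add: \<epsilon>_def abs_sgn mult.commute)
    then have eps_q0: "\<epsilon> * sum z (fst q0) < 0"
      using q0(2) M_pos by simp
    have eps_bound: "\<bar>\<epsilon> * sum z (fst q)\<bar> \<le> 1 / 2" if "q \<in> F" for q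
      using mult_left_mono[OF M_ge[OF pair(1)[OF that]], of "\<bar>\<epsilon>\<bar>"] eps_abs
      by (simp add: abs_mult)
    let ?y = "shift \<epsilon>"
    have "ord_class.lexordp (restricted_excess_vector cost F alloc)
        (restricted_excess_vector cost F ?y)"
      unfolding restricted_excess_vector_def
    \<comment> \<open>The threshold is the raised excess of \<open>q0\<close>.\<close>
    proof (rule lexordp_sorted_values[OF fin _ q0(1)])
      show "?e q0 < excess cost ?y q0"
        using excess_shift[OF q0(1)] eps_q0 by simp
      show "?e q \<le> excess cost ?y q" if q: "q \<in> F" "excess cost ?y q < excess cost ?y q0" for q
      proof -
        consider "?e q < ?e q0" | "?e q = ?e q0" | "?e q0 < ?e q"
          by linarith
        then show ?thesis
        proof cases
          case 1
          then have "sum z (fst q) = 0"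
            using q0_min[OF q(1)] by fastforce
          then show ?thesis
            using excess_shift[OF q(1)] by simp
        next
          case 2
          then show ?thesis
            using q0_only q by blast
        next
          \<comment> \<open>By the gap, an excess above that of \<open>q0\<close> cannot end up
            below the raised one.\<close>
          case 3
          then show ?thesis
            using gap[OF q(1)] q(2) eps_bound[OF q(1)] eps_bound[OF q0(1)]
              excess_shift[OF q(1), of \<epsilon>] excess_shift[OF q0(1), of \<epsilon>] by linarith
        qed
      qed
    qed simp
    moreover have "?y \<in> ?H"
      by (rule shift_happy) (use eps_abs in simp)
    moreover have "alloc \<in> lex_maximizers (restricted_excess_vector cost F) ?H"
      using max by simp
    ultimately show False
      by (auto simp: lex_maximizers_def lexordp_conv_lexordp_eq)
  qed
qed

end

theorem theorem3:
  fixes n :: nat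
  shows "\<exists>(P :: nat set) \<T> c.
           set_covering_instance P \<T> c \<and> card P = n \<and> core P \<T> c \<noteq> {} \<and>
           (\<forall>F. F \<subseteq> covering_pairs P \<T> \<and> int (card F) < 2 * int n - 2 \<longrightarrow>
                \<not> determines_happy_nucleolus P \<T> c F)"
proof (intro exI conjI allI impI)
  show "set_covering_instance {..<n} (Pow {..<n}) (cost n)"
    by (auto simp: set_covering_instance_def cost_nonneg)
  show "card {..<n} = n"
    by simp
  show "core {..<n} (Pow {..<n}) (cost n) \<noteq> {}"
    using alloc_in_core by blast
  show "\<not> determines_happy_nucleolus {..<n} (Pow {..<n}) (cost n) F"
    if "F \<subseteq> covering_pairs {..<n} (Pow {..<n}) \<and> int (card F) < 2 * int n - 2" for F
    using small_family_not_determining[of F n] that by linarith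
qed

end
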